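(* Let $d\ge 3$ be fixed. Then $\chi^{\mathsf{w}}_{2d-3,d}(n)=\Omega\!\left(\dfrac{\log n}{\log\log n}\right)$ as $n\to\infty$; that is, there are constants $c_d>0$ and $n_d$ such that for all $n\ge n_d$ there is a $d$-uniform hypergraph on $n$ vertices, linearly embeddable into $\mathbb{R}^{2d-3}$, with weak chromatic number at least $c_d\log n/\log\log n$.
   Context: A $k$-uniform hypergraph $H=(V,E)$ consists of a finite set $V$ and $E\subseteq\binom{V}{k}$. A (linear) embedding of $H$ into $\mathbb{R}^d$ is a map $\phi:V(H)\to\mathbb{R}^d$ with $\dim\operatorname{aff}\phi(e)=k-1$ for every edge $e$ and $\operatorname{conv}\phi(e_1)\cap\operatorname{conv}\phi(e_2)=\operatorname{conv}\phi(e_1\cap e_2)$ for all edges $e_1,e_2$. $\mathcal{E}_{d,k}$ is the set of $k$-uniform hypergraphs admitting such an embedding into $\mathbb{R}^d$. A weak $c$-coloring of $H$ is a map $\kappa:V(H)\to\{1,\dots,c\}$ with $|\kappa(e)|>1$ for every edge $e$; $\chi^{\mathsf{w}}(H)$ is the least such $c$. $\chi^{\mathsf{w}}_{d,k}(n)=\max\{\chi^{\mathsf{w}}(H): H\in\mathcal{E}_{d,k},\ |V(H)|=n\}$. *)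

theory Defs
  imports "HOL-Analysis.Analysis"
begin

definition uniform_hypergraph :: "nat \<Rightarrow> 'v set \<Rightarrow> 'v set set \<Rightarrow> bool" where
  "uniform_hypergraph k V E \<longleftrightarrow> finite V \<and> (\<forall>e\<in>E. e \<subseteq> V \<and> card e = k)"

definition linear_embedding ::
    "nat \<Rightarrow> 'v set \<Rightarrow> 'v set set \<Rightarrow> ('v \<Rightarrow> 'a::euclidean_space) \<Rightarrow> bool" where
  "linear_embedding k V E \<phi> \<longleftrightarrow>
     (\<forall>e\<in>E. aff_dim (\<phi> ` e) = int k - 1) \<and>
     (\<forall>e1\<in>E. \<forall>e2\<in>E. convex hull (\<phi> ` e1) \<inter> convex hull (\<phi> ` e2) = convex hull (\<phi> ` (e1 \<inter> e2)))"

definition embeddable :: "nat \<Rightarrow> 'v set \<Rightarrow> 'v set set \<Rightarrow> 'a::euclidean_space itself \<Rightarrow> bool" where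
  "embeddable k V E _ \<longleftrightarrow> (\<exists>\<phi> :: 'v \<Rightarrow> 'a. linear_embedding k V E \<phi>)"

definition weak_coloring :: "'v set \<Rightarrow> 'v set set \<Rightarrow> nat \<Rightarrow> ('v \<Rightarrow> nat) \<Rightarrow> bool" where
  "weak_coloring V E c \<kappa> \<longleftrightarrow> (\<forall>v\<in>V. \<kappa> v \<in> {1..c}) \<and> (\<forall>e\<in>E. card (\<kappa> ` e) > 1)"

definition weak_chromatic_number :: "'v set \<Rightarrow> 'v set set \<Rightarrow> nat" where
  "weak_chromatic_number V E = (LEAST c. \<exists>\<kappa>. weak_coloring V E c \<kappa>)"

end

theory Submission
  imports Defs "HOL-Library.Nat_Bijection"
begin

text \<open>
  Place the vertices on the moment curve in dimension m = 2d - 3. A common point of the hulls of two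
  edges outside the hull of their intersection gives a nonzero real function c on the vertices of
  the two edges, positive only on the first and negative only on the second, with vanishing moments
  of orders 0, ..., m. Such a c changes sign more than m times: otherwise a polynomial of degree at
  most m follows its signs. Hence any ordered hypergraph in which no two edges alternate more than m
  times embeds linearly.

  Let a hypergraph with that property need more than c colours. Take (c+1)(d-2)+1 spine vertices
  and, for each (d-1)-set S of them, a copy of the hypergraph (the block of S), all of
  whose vertices v are joined to S by an edge \<open>S \<union> {v}\<close> (a page). With c + 1 colours, some S is
  monochromatic by pigeonhole, while its block uses every colour, so some page is monochromatic.
  Ordering the blocks colexicographically, each one after the spine vertices of its S and before the
  next spine vertex, keeps the number of alternations at most m. The number of vertices is at most
  \<open>(c * d) ^ (d * c)\<close>, so c can be chosen of order log n / log log n.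
\<close>

subsection \<open>Alternation of two sets in a linear order\<close>

text \<open>An alternation is recorded by its left end: \<open>u\<close> is the successor of
  \<open>r\<close> in \<open>X\<close>, and the label \<open>Q\<close> changes between the
  two.\<close>

definition switches :: "'a::linorder set \<Rightarrow> ('a \<Rightarrow> bool) \<Rightarrow> 'a set" where
  "switches X Q = {r\<in>X. \<exists>u\<in>X. r < u \<and> (\<forall>x\<in>X. x \<le> r \<or> u \<le> x) \<and> Q r \<noteq> Q u}"

text \<open>\<open>X\<close> is any selection of points, each assigned by \<open>Q\<close> to one of
  the two sets. A common point of \<open>A\<close> and \<open>B\<close> may be assigned to either,
  just as the coefficient of a common vertex may have either sign.\<close>

definition noncrossing :: "nat \<Rightarrow> 'a::linorder set \<Rightarrow> 'a set \<Rightarrow> bool" where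
  "noncrossing m A B \<longleftrightarrow>
     (\<forall>X Q. (\<forall>x\<in>X. if Q x then x \<in> A else x \<in> B) \<longrightarrow> card (switches X Q) \<le> m)"

lemma noncrossingD:
  assumes "noncrossing m A B" "\<And>x. x \<in> X \<Longrightarrow> Q x \<Longrightarrow> x \<in> A" "\<And>x. x \<in> X \<Longrightarrow> \<not> Q x \<Longrightarrow> x \<in> B"
  shows "card (switches X Q) \<le> m"
  using assms unfolding noncrossing_def by auto

lemma noncrossingI:
  assumes "\<And>X Q. (\<And>x. x \<in> X \<Longrightarrow> Q x \<Longrightarrow> x \<in> A) \<Longrightarrow> (\<And>x. x \<in> X \<Longrightarrow> \<not> Q x \<Longrightarrow> x \<in> B) \<Longrightarrow> card (switches X Q) \<le> m"
  shows "noncrossing m A B"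
  unfolding noncrossing_def by (intro allI impI assms) (auto split: if_splits)

lemma switches_subset: "switches X Q \<subseteq> X"
  unfolding switches_def by auto

lemma switches_Not [simp]: "switches X (\<lambda>x. \<not> Q x) = switches X Q"
  unfolding switches_def by auto

lemma noncrossing_sym:
  assumes "noncrossing m A B"
  shows "noncrossing m B A"
proof (rule noncrossingI)
  fix X Q
  assume "\<And>x. x \<in> X \<Longrightarrow> Q x \<Longrightarrow> x \<in> B" "\<And>x. x \<in> X \<Longrightarrow> \<not> Q x \<Longrightarrow> x \<in> A"
  then have "card (switches X (\<lambda>x. \<not> Q x)) \<le> m"
    by (intro noncrossingD[OF assms]) auto
  then show "card (switches X Q) \<le> m" by simp
qed

lemma noncrossing_image:
  fixes f :: "'a::linorder \<Rightarrow> 'b::linorder"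
  assumes nc: "noncrossing m A B" and f: "strict_mono f"
  shows "noncrossing m (f ` A) (f ` B)"
proof (rule noncrossingI)
  fix X Q
  assume Q: "\<And>x. x \<in> X \<Longrightarrow> Q x \<Longrightarrow> x \<in> f ` A" "\<And>x. x \<in> X \<Longrightarrow> \<not> Q x \<Longrightarrow> x \<in> f ` B"
  have inj: "inj f" using f by (rule strict_mono_imp_inj_on)
  have "X \<subseteq> range f" using Q by blast
  then obtain Y where X: "X = f ` Y" by (meson subset_image_iff)
  have "f r \<in> switches X Q \<longleftrightarrow> r \<in> switches Y (Q \<circ> f)" for r
    unfolding switches_def X using f inj
    by (simp add: strict_mono_less strict_mono_less_eq inj_image_mem_iff)
  then have "f -` switches X Q = switches Y (Q \<circ> f)" by blast
  moreover have "switches X Q \<subseteq> range f" using switches_subset \<open>X \<subseteq> range f\<close> by (rule subset_trans)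
  ultimately have "switches X Q = f ` switches Y (Q \<circ> f)"
    by (metis image_vimage_eq inf.absorb1)
  moreover have "card (switches Y (Q \<circ> f)) \<le> m"
  proof (rule noncrossingD[OF nc])
    fix x assume "x \<in> Y"
    then show "(Q \<circ> f) x \<Longrightarrow> x \<in> A" "\<not> (Q \<circ> f) x \<Longrightarrow> x \<in> B"
      using Q[of "f x"] inj by (simp_all add: X inj_image_mem_iff)
  qed
  ultimately show "card (switches X Q) \<le> m"
    using inj by (simp add: card_image inj_on_subset)
qed

section \<open>Sufficient conditions for few alternations\<close>

text \<open>A switch and its successor come from different sets, so the level strictly rises between
  them. Hence \<open>f\<close> is injective on the switches, with values below \<open>m\<close>
  because the successor still has level at most \<open>m\<close>.\<close>

lemma noncrossing_monotone_levels:
  fixes f :: "'a::linorder \<Rightarrow> nat"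
  assumes mono: "\<And>x y. x \<in> A \<union> B \<Longrightarrow> y \<in> A \<union> B \<Longrightarrow> x \<le> y \<Longrightarrow> f x \<le> f y"
    and le: "\<And>x. x \<in> A \<union> B \<Longrightarrow> f x \<le> m"
    and sep: "\<And>x y. x \<in> A \<Longrightarrow> y \<in> B \<Longrightarrow> f x = f y \<Longrightarrow> x = y"
  shows "noncrossing m A B"
proof (rule noncrossingI)
  fix X Q
  assume Q: "\<And>x. x \<in> X \<Longrightarrow> Q x \<Longrightarrow> x \<in> A" "\<And>x. x \<in> X \<Longrightarrow> \<not> Q x \<Longrightarrow> x \<in> B"
  have X: "x \<in> A \<union> B" if "x \<in> X" for x using Q that by blast
  have lt: "f r < f u" if "r \<in> X" "u \<in> X" "r < u" "Q r \<noteq> Q u" for r u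
    using mono[OF X X, of r u] sep[of r u] sep[of u r] Q that by (metis less_imp_le less_irrefl order_le_imp_less_or_eq)
  have step: "\<exists>u\<in>X. r < u \<and> (\<forall>x\<in>X. x \<le> r \<or> u \<le> x) \<and> f r < f u" if "r \<in> switches X Q" for r
    using that lt unfolding switches_def by blast
  note sub = switches_subset[of X Q]
  have less: "f r < f s" if "r \<in> switches X Q" "s \<in> switches X Q" "r < s" for r s
    using step[OF that(1)] that sub mono X by (metis leD order_less_le_trans subsetD)
  have "inj_on f (switches X Q)"
    by (rule linorder_inj_onI') (use less in fastforce)
  moreover have "f ` switches X Q \<subseteq> {..<m}"
    using step le X by (fastforce dest: order_less_le_trans)
  ultimately show "card (switches X Q) \<le> m"
    by (metis card_inj_on_le card_lessThan finite_lessThan)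
qed

lemma switches_imp_less:
  assumes "r \<in> switches X Q"
  shows "r \<in> X" "\<exists>u\<in>X. r < u"
  using assms unfolding switches_def by auto

lemma switchesD:
  assumes "r \<in> switches X Q" "u \<in> X" "r < u" "\<And>x. x \<in> X \<Longrightarrow> x \<le> r \<or> u \<le> x"
  shows "Q r \<noteq> Q u"
proof -
  obtain w where w: "w \<in> X" "r < w" "\<And>x. x \<in> X \<Longrightarrow> x \<le> r \<or> w \<le> x" "Q r \<noteq> Q w"
    using assms(1) unfolding switches_def by blast
  have "w \<le> u" "u \<le> w" using w(3)[OF assms(2)] assms(4)[OF w(1)] w(2) assms(3) by auto
  then show ?thesis using w(4) by simp
qed

text \<open>The largest point of \<open>X\<close> is never a switch.\<close>

lemma noncrossing_if_card_Un:
  assumes fin: "finite (A \<union> B)" and card: "card (A \<union> B) \<le> Suc m"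
  shows "noncrossing m A B"
proof (rule noncrossingI)
  fix X Q
  assume Q: "\<And>x. x \<in> X \<Longrightarrow> Q x \<Longrightarrow> x \<in> A" "\<And>x. x \<in> X \<Longrightarrow> \<not> Q x \<Longrightarrow> x \<in> B"
  have X: "X \<subseteq> A \<union> B" using Q by blast
  show "card (switches X Q) \<le> m"
  proof (cases "X = {}")
    case False
    have finX: "finite X" using X fin finite_subset by blast
    have "switches X Q \<subseteq> X - {Max X}"
      using switches_imp_less[of _ X Q] finX by (metis Diff_iff Max_ge leD singletonD subsetI)
    then have "card (switches X Q) \<le> card (X - {Max X})"
      using finX by (intro card_mono) auto
    also have "\<dots> = card X - 1" using finX False by simp
    also have "\<dots> \<le> m" using card card_mono[OF fin X] by linarith
    finally show ?thesis .
  qed (simp add: switches_def)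
qed

text \<open>
  Of the points of \<open>A \<union> B\<close>, neither \<open>q\<close> nor \<open>w\<close> is a switch, and if \<open>A\<close> and \<open>B\<close> are disjoint then
  \<open>p\<close> and \<open>v\<close> are not both switches.
\<close>

lemma noncrossing_two_pairs:
  assumes fin: "finite A" "finite B" and card: "card A = d" "card B = d"
    and A: "p \<in> A" "v \<in> A" "v \<notin> B" "p < v" "\<And>x. x \<in> A \<union> B \<Longrightarrow> x \<le> p \<or> v \<le> x"
    and B: "q \<in> B" "w \<in> B" "q \<notin> A" "w \<notin> A" "q < w" "\<And>x. x \<in> A \<union> B \<Longrightarrow> x \<le> q \<or> x = w"
  shows "noncrossing (2 * d - 3) A B"
proof (rule noncrossingI)
  fix X Q
  assume Q: "\<And>x. x \<in> X \<Longrightarrow> Q x \<Longrightarrow> x \<in> A" "\<And>x. x \<in> X \<Longrightarrow> \<not> Q x \<Longrightarrow> x \<in> B"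
  have X: "X \<subseteq> A \<union> B" using Q by blast
  let ?S = "switches X Q"
  have w: "w \<notin> ?S" using switches_imp_less[of w X Q] B X by force
  \<comment> \<open>Only \<open>w\<close> lies above \<open>q\<close>, and both belong to
    \<open>B\<close> alone, so the label cannot change after \<open>q\<close>.\<close>
  have q: "q \<notin> ?S"
  proof
    assume a: "q \<in> ?S"
    then have "w \<in> X" using switches_imp_less[of q X Q] B X by fastforce
    then have "Q q \<noteq> Q w" using switchesD[OF a, of w] B X by blast
    then show False using Q \<open>w \<in> X\<close> switches_imp_less(1)[OF a] B by blast
  qed
  have sub: "?S \<subseteq> A \<union> B - {q, w}" using w q X switches_subset[of X Q] by auto
  have cu: "card (A \<union> B) + card (A \<inter> B) = 2 * d" using card_Un_Int[OF fin] card by simp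
  \<comment> \<open>A common point brings the union down to at most 2d - 1 points, of which two are
    excluded; disjoint sets have 2d points, of which three are excluded.\<close>
  show "card ?S \<le> 2 * d - 3"
  proof (cases "A \<inter> B = {}")
    case False
    then have "card (A \<inter> B) \<ge> 1" using fin by (simp add: Suc_leI card_gt_0_iff)
    moreover have "card ?S \<le> card (A \<union> B - {q, w})"
      using sub fin by (intro card_mono) auto
    moreover have "card (A \<union> B - {q, w}) = card (A \<union> B) - 2"
      using fin B by (subst card_Diff_subset) auto
    ultimately show ?thesis using cu by linarith
  next
    case True
    have "\<not> (p \<in> ?S \<and> v \<in> ?S)"
    proof
      assume a: "p \<in> ?S \<and> v \<in> ?S"
      then have mX: "p \<in> X" "v \<in> X" using switches_subset by auto
      then have "Q p \<noteq> Q v" using a switchesD[of p X Q v] A X by auto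
      moreover have "p \<notin> B" using A True by auto
      then have "Q p" "Q v" using Q mX A by metis+
      ultimately show False by blast
    qed
    then obtain z where z: "z \<in> {p, v}" "z \<notin> ?S" by auto
    have "card ?S \<le> card (A \<union> B - {q, w, z})"
      using sub fin z by (intro card_mono) auto
    moreover have "z \<notin> {q, w}" using z A(1,2) B(3,4) by auto
    then have "card {q, w, z} = 3" using B(5) by auto
    then have "card (A \<union> B - {q, w, z}) = card (A \<union> B) - 3"
      using fin B A z by (subst card_Diff_subset) auto
    ultimately show ?thesis using cu by linarith
  qed
qed

text \<open>
  If \<open>q\<close>, \<open>p\<close>, \<open>v\<close> were all switches, then the common point \<open>p\<close> would have to be of type \<open>A\<close> to
  differ from \<open>q\<close> and of type \<open>B\<close> to differ from \<open>v\<close>. The order of \<open>v\<close> and \<open>w\<close> matters here.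
\<close>

lemma noncrossing_common_point:
  assumes fin: "finite A" "finite B" and card: "card A = d" "card B = d"
    and AB: "A \<inter> B = {p}"
    and mem: "v \<in> A" "q \<in> B" "w \<in> B" and ord: "q < p" "p < v" "v < w"
    and gap: "\<And>x. x \<in> A \<union> B \<Longrightarrow> x \<le> q \<or> p \<le> x" "\<And>x. x \<in> A \<union> B \<Longrightarrow> x \<le> p \<or> v \<le> x"
      "\<And>x. x \<in> A \<union> B \<Longrightarrow> x \<le> w"
  shows "noncrossing (2 * d - 3) A B"
proof (rule noncrossingI)
  fix X Q
  assume Q: "\<And>x. x \<in> X \<Longrightarrow> Q x \<Longrightarrow> x \<in> A" "\<And>x. x \<in> X \<Longrightarrow> \<not> Q x \<Longrightarrow> x \<in> B"
  have X: "X \<subseteq> A \<union> B" using Q by blast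
  let ?S = "switches X Q"
  have w: "w \<notin> ?S" using switches_imp_less[of w X Q] gap(3) X by force
  have cu: "card (A \<union> B) + 1 = 2 * d" using card_Un_Int[OF fin] card AB by simp
  have "\<not> {q, p, v} \<subseteq> ?S"
  proof
    assume a: "{q, p, v} \<subseteq> ?S"
    have mX: "q \<in> X" "p \<in> X" "v \<in> X" using a switches_subset[of X Q] by auto
    have "Q p \<noteq> Q v" using switchesD[of p X Q v] a mX ord gap X by auto
    moreover have "Q q \<noteq> Q p" using switchesD[of q X Q p] a mX ord gap X by auto
    moreover have "v \<notin> B" "q \<notin> A" using mem AB ord by auto
    then have "Q v" "\<not> Q q" using Q mX by metis+
    ultimately show False by blast
  qed
  \<comment> \<open>The union has 2d - 1 points, and neither \<open>w\<close> nor \<open>z\<close>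
    is a switch.\<close>
  then obtain z where z: "z \<in> {q, p, v}" "z \<notin> ?S" by auto
  have "?S \<subseteq> A \<union> B - {w, z}" using w z X switches_subset[of X Q] by auto
  then have "card ?S \<le> card (A \<union> B - {w, z})"
    using fin by (intro card_mono) auto
  moreover have "card {w, z} = 2" using z ord by auto
  then have "card (A \<union> B - {w, z}) = card (A \<union> B) - 2"
    using fin mem AB z by (subst card_Diff_subset) auto
  ultimately show "card ?S \<le> 2 * d - 3" using cu by linarith
qed


subsection \<open>The moment curve\<close>

text \<open>
  The roots are the last elements of the maximal runs on which \<open>Q\<close> is constant, except the last run,
  so the product vanishes at some points but not at the maximum. The last conjunct is there only to
  make the induction work.
\<close>

lemma sign_following_polynomial:
  fixes X :: "real set" and Q :: "real \<Rightarrow> bool"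
  assumes "finite X" "X \<noteq> {}"
  shows "\<exists>\<sigma>\<in>{1, -1}. (\<forall>x\<in>X. 0 \<le> (if Q x then 1 else -1) * \<sigma> * (\<Prod>r\<in>switches X Q. x - r))
     \<and> (\<exists>x\<in>X. (\<Prod>r\<in>switches X Q. x - r) \<noteq> 0)
     \<and> (if Q (Min X) then 1 else -1) * \<sigma> = (-1) ^ card (switches X Q)"
  using assms
proof (induction X rule: finite_linorder_min_induct)
  case (insert b X)
  let ?s = "\<lambda>x. if Q x then 1 else -1 :: real"
  show ?case
  proof (cases "X = {}")
    case True
    have "switches {b} Q = {}" unfolding switches_def by auto
    then show ?thesis using True by auto
  next
    case False
    let ?S = "switches X Q"
    obtain \<sigma> where \<sigma>: "\<sigma> \<in> {1, -1}" "\<And>x. x \<in> X \<Longrightarrow> 0 \<le> ?s x * \<sigma> * (\<Prod>r\<in>?S. x - r)"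
      "\<exists>x\<in>X. (\<Prod>r\<in>?S. x - r) \<noteq> 0" "?s (Min X) * \<sigma> = (-1) ^ card ?S"
      using insert.IH[OF False] by blast
    have sub: "?S \<subseteq> X" using switches_imp_less(1) by blast
    have finS: "finite ?S" using sub insert.hyps(1) finite_subset by blast
    have bS: "b \<notin> ?S" using sub insert.hyps(2) by auto
    have minX: "Min X \<in> X" "\<And>x. x \<in> X \<Longrightarrow> Min X \<le> x" using insert.hyps(1) False by auto
    have minb: "Min (insert b X) = b"
      using insert.hyps by (intro Min_eqI) (auto simp: less_imp_le)
    have bX: "b \<notin> X" using insert.hyps(2) by auto
    \<comment> \<open>The new minimum \<open>b\<close> is a switch exactly if its label differs from
      that of the old minimum; the other switches stay.\<close>
    have sw: "switches (insert b X) Q = (if Q b = Q (Min X) then ?S else insert b ?S)"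
      (is "?L = ?R")
    proof (intro set_eqI)
      fix r
      show "r \<in> ?L \<longleftrightarrow> r \<in> ?R"
      proof (cases "r = b")
        case True
        have "(\<exists>u\<in>insert b X. b < u \<and> (\<forall>x\<in>insert b X. x \<le> b \<or> u \<le> x) \<and> Q b \<noteq> Q u) \<longleftrightarrow> Q b \<noteq> Q (Min X)"
          using minX insert.hyps(2) by (metis insert_iff leD order_antisym order_refl)
        then show ?thesis using True bS bX unfolding switches_def by (auto split: if_splits)
      next
        case False
        have "\<not> r < b \<and> b \<le> r" if "r \<in> X" using insert.hyps(2) that by (auto simp: less_imp_le not_less)
        then have "r \<in> ?L \<longleftrightarrow> r \<in> ?S"
          unfolding switches_def using False by auto
        then show ?thesis using False by auto
      qed
    qed
    have prod_flip: "(\<Prod>r\<in>?S. b - r) = (-1) ^ card ?S * (\<Prod>r\<in>?S. r - b)"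
      by (simp flip: prod_constant prod.distrib)
    have pos: "0 < (\<Prod>r\<in>?S. r - b)"
      using sub insert.hyps(2) by (intro prod_pos) auto
    show ?thesis
    proof (cases "Q b = Q (Min X)")
      case True
      \<comment> \<open>At \<open>b\<close> every factor is negative, so the product has the sign
        \<open>(-1) ^ card ?S\<close>, which the last conjunct matches with the label.\<close>
      have "0 \<le> ?s b * \<sigma> * (\<Prod>r\<in>?S. b - r)"
      proof -
        have "?s b * \<sigma> * (\<Prod>r\<in>?S. b - r) = ((-1) ^ card ?S * (-1) ^ card ?S) * (\<Prod>r\<in>?S. r - b)"
          using \<sigma>(4) True prod_flip by simp
        also have "\<dots> = (\<Prod>r\<in>?S. r - b)" by (simp flip: power_add)
        finally show ?thesis using pos by simp
      qed
      then show ?thesis using \<sigma> True by (intro bexI[of _ \<sigma>]) (auto simp: sw minb)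
    next
      case False
      \<comment> \<open>The new factor is 0 at \<open>b\<close> and positive to its right, so
        \<open>\<sigma>\<close> can stay; the label of the minimum and the parity of the number of
        roots both flip.\<close>
      have eq: "(\<Prod>r\<in>insert b ?S. x - r) = (x - b) * (\<Prod>r\<in>?S. x - r)" for x
        using finS bS by simp
      have "0 \<le> ?s x * \<sigma> * (\<Prod>r\<in>insert b ?S. x - r)" if "x \<in> insert b X" for x
      proof (cases "x = b")
        case False
        then have "x \<in> X" using that by simp
        then have "0 \<le> x - b" using insert.hyps(2) by (simp add: less_imp_le)
        then have "0 \<le> (x - b) * (?s x * \<sigma> * (\<Prod>r\<in>?S. x - r))"
          using \<sigma>(2)[OF \<open>x \<in> X\<close>] by (rule mult_nonneg_nonneg)
        then show ?thesis unfolding eq by (simp only: mult.assoc mult.left_commute)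
      qed (simp add: eq)
      moreover have "\<exists>x\<in>insert b X. (\<Prod>r\<in>insert b ?S. x - r) \<noteq> 0"
        using \<sigma>(3) insert.hyps(2) unfolding eq by fastforce
      moreover have "?s b * \<sigma> = (-1) ^ card (insert b ?S)"
        using \<sigma>(4) False finS bS by (auto split: if_splits)
      ultimately show ?thesis using \<sigma>(1) False
        unfolding sw minb by (intro bexI[of _ \<sigma>]) auto
    qed
  qed
qed simp

text \<open>The product is a polynomial of degree at most \<open>m\<close>, so the sum combines
  vanishing moments. Peeling off one root at a time avoids expanding it, at the price of an extra
  power \<open>t ^ j\<close> in the induction.\<close>

lemma sum_mult_prod_roots_eq_0:
  fixes c :: "real \<Rightarrow> real"
  assumes "finite R" "card R \<le> m" "\<And>i. i \<le> m \<Longrightarrow> (\<Sum>t\<in>X. c t * t ^ i) = 0"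
  shows "(\<Sum>t\<in>X. c t * (\<Prod>r\<in>R. t - r)) = 0"
proof -
  have "(\<Sum>t\<in>X. c t * t ^ j * (\<Prod>r\<in>R. t - r)) = 0" if "j + card R \<le> m" for j
    using assms(1) that
  proof (induction R arbitrary: j rule: finite_induct)
    case empty
    then show ?case using assms(3) by simp
  next
    case (insert r R)
    have "(\<Sum>t\<in>X. c t * t ^ j * (\<Prod>r\<in>insert r R. t - r))
      = (\<Sum>t\<in>X. c t * t ^ Suc j * (\<Prod>r\<in>R. t - r)) - r * (\<Sum>t\<in>X. c t * t ^ j * (\<Prod>r\<in>R. t - r))"
      using insert.hyps by (simp add: sum_distrib_left flip: sum_subtractf) (simp add: algebra_simps)
    also have "\<dots> = 0"
      using insert.IH[of "Suc j"] insert.IH[of j] insert.prems insert.hyps by simp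
    finally show ?case .
  qed
  from this[of 0] assms(2) show ?thesis by simp
qed

text \<open>Otherwise summing \<open>c\<close> against the sign-following polynomial gives 0
  although no two terms have opposite signs; so all terms vanish, while the polynomial is nonzero
  somewhere on \<open>X\<close>.\<close>

lemma card_switches_of_vanishing_moments:
  fixes c :: "real \<Rightarrow> real"
  assumes fin: "finite X" and ne: "X \<noteq> {}" and nz: "\<And>t. t \<in> X \<Longrightarrow> c t \<noteq> 0"
    and moments: "\<And>i. i \<le> m \<Longrightarrow> (\<Sum>t\<in>X. c t * t ^ i) = 0"
  shows "m < card (switches X (\<lambda>t. 0 < c t))"
proof (rule ccontr)
  let ?S = "switches X (\<lambda>t. 0 < c t)"
  assume "\<not> m < card ?S"
  moreover have "finite ?S" using fin finite_subset switches_imp_less(1) by (metis subsetI)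
  ultimately have z: "(\<Sum>t\<in>X. c t * (\<Prod>r\<in>?S. t - r)) = 0"
    using moments by (intro sum_mult_prod_roots_eq_0[of _ m]) auto
  obtain \<sigma> :: real where \<sigma>: "\<sigma> \<in> {1, -1}"
      "\<And>x. x \<in> X \<Longrightarrow> 0 \<le> (if 0 < c x then 1 else -1) * \<sigma> * (\<Prod>r\<in>?S. x - r)"
      "\<exists>x\<in>X. (\<Prod>r\<in>?S. x - r) \<noteq> 0"
    using sign_following_polynomial[OF fin ne, of "\<lambda>t. 0 < c t"] by blast
  have nn: "0 \<le> \<sigma> * (c x * (\<Prod>r\<in>?S. x - r))" if x: "x \<in> X" for x
  proof -
    have "0 \<le> \<bar>c x\<bar> * ((if 0 < c x then 1 else -1) * \<sigma> * (\<Prod>r\<in>?S. x - r))"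
      by (rule mult_nonneg_nonneg[OF abs_ge_zero \<sigma>(2)[OF x]])
    also have "\<dots> = \<sigma> * (c x * (\<Prod>r\<in>?S. x - r))"
      using nz[OF x] by (auto simp: abs_if)
    finally show ?thesis .
  qed
  have "(\<Sum>x\<in>X. \<sigma> * (c x * (\<Prod>r\<in>?S. x - r))) = 0"
    using z by (simp flip: sum_distrib_left)
  then have "\<forall>x\<in>X. \<sigma> * (c x * (\<Prod>r\<in>?S. x - r)) = 0"
    using nn fin by (subst (asm) sum_nonneg_eq_0_iff) auto
  then show False using \<sigma>(1,3) nz by fastforce
qed

section \<open>Convex hulls and affine independence on the moment curve\<close>

text \<open>\<open>\<iota>\<close> is meant to number the coordinates from 0, so that they are the
  powers from 1 to the dimension. The moment of order 0 comes from the vanishing sum of affine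
  coefficients.\<close>

definition moment_curve :: "('n::finite \<Rightarrow> nat) \<Rightarrow> real \<Rightarrow> real ^ 'n" where
  "moment_curve \<iota> t = (\<chi> k. t ^ Suc (\<iota> k))"

lemma moments_of_moment_curve:
  fixes \<iota> :: "'n::finite \<Rightarrow> nat"
  assumes \<iota>: "range \<iota> = {..<CARD('n)}"
    and "(\<Sum>t\<in>X. c t) = 0" "(\<Sum>t\<in>X. c t *\<^sub>R moment_curve \<iota> t) = 0" "i \<le> CARD('n)"
  shows "(\<Sum>t\<in>X. c t * t ^ i) = 0"
proof (cases i)
  case 0
  then show ?thesis using assms by simp
next
  case (Suc j)
  then obtain k where "\<iota> k = j" using \<iota> assms(4) by (metis Suc_le_eq imageE lessThan_iff)
  moreover have "(\<Sum>t\<in>X. c t *\<^sub>R moment_curve \<iota> t) $ k = 0" using assms(3) by simp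
  ultimately show ?thesis using Suc by (simp add: moment_curve_def)
qed

text \<open>For \<open>A = B\<close> this yields affine independence; for two edges it forces two
  convex representations of a point to agree.\<close>

lemma moment_curve_coeffs_eq_0:
  fixes \<iota> :: "'n::finite \<Rightarrow> nat"
  assumes \<iota>: "range \<iota> = {..<CARD('n)}" and fin: "finite X"
    and sum: "(\<Sum>t\<in>X. c t) = 0" "(\<Sum>t\<in>X. c t *\<^sub>R moment_curve \<iota> t) = 0"
    and nc: "noncrossing CARD('n) A B"
    and A: "\<And>t. t \<in> X \<Longrightarrow> 0 < c t \<Longrightarrow> t \<in> A" and B: "\<And>t. t \<in> X \<Longrightarrow> c t < 0 \<Longrightarrow> t \<in> B"
    and "t \<in> X"
  shows "c t = 0"
proof (rule ccontr)
  assume "c t \<noteq> 0"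
  \<comment> \<open>Zero coefficients must be left out, since the label \<open>0 < c t\<close> would
    count them as negative.\<close>
  let ?X = "{t\<in>X. c t \<noteq> 0}"
  have "(\<Sum>t\<in>?X. c t * t ^ i) = 0" if "i \<le> CARD('n)" for i
  proof -
    have "(\<Sum>t\<in>?X. c t * t ^ i) = (\<Sum>t\<in>X. c t * t ^ i)"
      using fin by (intro sum.mono_neutral_left) auto
    then show ?thesis using moments_of_moment_curve[OF \<iota> sum that] by simp
  qed
  then have "CARD('n) < card (switches ?X (\<lambda>t. 0 < c t))"
    using fin \<open>c t \<noteq> 0\<close> \<open>t \<in> X\<close> by (intro card_switches_of_vanishing_moments) auto
  moreover have "card (switches ?X (\<lambda>t. 0 < c t)) \<le> CARD('n)"
    using A B by (intro noncrossingD[OF nc]) auto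
  ultimately show False by simp
qed

lemma inj_moment_curve:
  fixes \<iota> :: "'n::finite \<Rightarrow> nat"
  assumes \<iota>: "range \<iota> = {..<CARD('n)}"
  shows "inj (moment_curve \<iota>)"
proof (rule injI)
  fix s t assume eq: "moment_curve \<iota> s = moment_curve \<iota> t"
  have "0 \<in> range \<iota>" using \<iota> by simp
  then obtain k where "\<iota> k = 0" by auto
  then show "s = t" using arg_cong[OF eq, of "\<lambda>x. x $ k"] by (simp add: moment_curve_def)
qed

lemma convex_hull_image_inj:
  fixes f :: "'b \<Rightarrow> 'a::real_vector"
  assumes "finite A" "inj_on f A"
  shows "convex hull (f ` A) = {\<Sum>t\<in>A. u t *\<^sub>R f t |u. (\<forall>t\<in>A. 0 \<le> u t) \<and> sum u A = 1}"
proof (intro equalityI subsetI)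
  fix y assume "y \<in> convex hull (f ` A)"
  then obtain u where "\<forall>x\<in>f ` A. 0 \<le> u x" "sum u (f ` A) = 1" "(\<Sum>x\<in>f ` A. u x *\<^sub>R x) = y"
    using assms(1) by (auto simp: convex_hull_finite)
  then show "y \<in> {\<Sum>t\<in>A. u t *\<^sub>R f t |u. (\<forall>t\<in>A. 0 \<le> u t) \<and> sum u A = 1}"
    using assms(2) by (intro CollectI exI[of _ "u \<circ> f"]) (auto simp: sum.reindex)
next
  fix y assume "y \<in> {\<Sum>t\<in>A. u t *\<^sub>R f t |u. (\<forall>t\<in>A. 0 \<le> u t) \<and> sum u A = 1}"
  then show "y \<in> convex hull (f ` A)"
    using assms(1) by (auto intro!: convex_sum simp: hull_inc)
qed

lemma moment_curve_convex_hull_Int: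
  fixes \<iota> :: "'n::finite \<Rightarrow> nat"
  assumes \<iota>: "range \<iota> = {..<CARD('n)}" and fin: "finite A" "finite B"
    and nc: "noncrossing CARD('n) A B"
  shows "convex hull (moment_curve \<iota> ` A) \<inter> convex hull (moment_curve \<iota> ` B)
    = convex hull (moment_curve \<iota> ` (A \<inter> B))"
proof (intro equalityI subsetI)
  let ?g = "moment_curve \<iota>"
  have inj: "inj_on ?g X" for X using inj_moment_curve[OF \<iota>] inj_on_subset by blast
  fix p assume "p \<in> convex hull (?g ` A) \<inter> convex hull (?g ` B)"
  then obtain u v where u: "\<forall>t\<in>A. 0 \<le> u t" "sum u A = 1" "p = (\<Sum>t\<in>A. u t *\<^sub>R ?g t)"
    and v: "\<forall>t\<in>B. 0 \<le> v t" "sum v B = 1" "p = (\<Sum>t\<in>B. v t *\<^sub>R ?g t)"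
    using fin by (auto simp: convex_hull_image_inj inj)
  \<comment> \<open>The difference of the two representations, each extended by 0, is positive only
    on \<open>A\<close> and negative only on \<open>B\<close>.\<close>
  define c where "c t = (if t \<in> A then u t else 0) - (if t \<in> B then v t else 0)" for t
  have ext: "(\<Sum>t\<in>A \<union> B. (if t \<in> A then u t else 0) *\<^sub>R h t) = (\<Sum>t\<in>A. u t *\<^sub>R h t)"
      "(\<Sum>t\<in>A \<union> B. (if t \<in> B then v t else 0) *\<^sub>R h t) = (\<Sum>t\<in>B. v t *\<^sub>R h t)"
    for h :: "real \<Rightarrow> 'z::real_vector"
    using fin by (auto intro!: sum.mono_neutral_cong_right)
  have c: "(\<Sum>t\<in>A \<union> B. c t *\<^sub>R h t) = (\<Sum>t\<in>A. u t *\<^sub>R h t) - (\<Sum>t\<in>B. v t *\<^sub>R h t)"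
    for h :: "real \<Rightarrow> 'z::real_vector"
    unfolding c_def scaleR_left_diff_distrib sum_subtractf ext ..
  have c0: "c t = 0" if "t \<in> A \<union> B" for t
  proof (rule moment_curve_coeffs_eq_0[OF \<iota> _ _ _ nc, where c = c])
    show "sum c (A \<union> B) = 0" using c[of "\<lambda>_. 1::real"] u v by simp
    show "(\<Sum>t\<in>A \<union> B. c t *\<^sub>R ?g t) = 0" using c[of ?g] u v by simp
  qed (use fin u v that in \<open>auto simp: c_def split: if_splits\<close>)
  \<comment> \<open>Outside \<open>B\<close> the difference \<open>c\<close> is just
    \<open>u\<close>, so the representation by \<open>u\<close> is supported on
    \<open>A \<inter> B\<close>.\<close>
  have u0: "u t = 0" if "t \<in> A - A \<inter> B" for t
    using c0[of t] that by (simp add: c_def)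
  have "sum u (A \<inter> B) = sum u A" "(\<Sum>t\<in>A \<inter> B. u t *\<^sub>R ?g t) = (\<Sum>t\<in>A. u t *\<^sub>R ?g t)"
    by (rule sum.mono_neutral_left; use fin u0 in force)+
  then show "p \<in> convex hull (?g ` (A \<inter> B))"
    using fin u by (auto simp: convex_hull_image_inj inj intro!: exI[of _ u])
next
  fix p assume "p \<in> convex hull (moment_curve \<iota> ` (A \<inter> B))"
  then show "p \<in> convex hull (moment_curve \<iota> ` A) \<inter> convex hull (moment_curve \<iota> ` B)"
    by (meson IntI hull_mono image_mono inf_le1 inf_le2 subsetD)
qed

lemma moment_curve_aff_dim:
  fixes \<iota> :: "'n::finite \<Rightarrow> nat"
  assumes \<iota>: "range \<iota> = {..<CARD('n)}" and fin: "finite A" and card: "card A \<le> Suc CARD('n)"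
  shows "aff_dim (moment_curve \<iota> ` A) = int (card A) - 1"
proof -
  let ?g = "moment_curve \<iota>"
  have inj: "inj_on ?g A" using inj_moment_curve[OF \<iota>] inj_on_subset by blast
  \<comment> \<open>With the same set on both sides, the coefficients may have any signs.\<close>
  have nc: "noncrossing CARD('n) A A"
    using fin card by (intro noncrossing_if_card_Un) auto
  have "\<not> affine_dependent (?g ` A)"
  proof
    assume "affine_dependent (?g ` A)"
    then obtain U where U: "sum U (?g ` A) = 0" "\<exists>x\<in>?g ` A. U x \<noteq> 0" "(\<Sum>x\<in>?g ` A. U x *\<^sub>R x) = 0"
      using fin by (auto simp: affine_dependent_explicit_finite)
    have "U (?g t) = 0" if "t \<in> A" for t
      using U inj that by (intro moment_curve_coeffs_eq_0[OF \<iota> fin _ _ nc, where c = "\<lambda>t. U (?g t)"])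
        (auto simp: sum.reindex)
    then show False using U(2) by blast
  qed
  then show ?thesis using aff_dim_affine_independent[of "?g ` A"] inj
    by (simp add: card_image)
qed

subsection \<open>Spine, blocks and pages\<close>

lemma set_encode_less_power:
  assumes "S \<subseteq> {..<k}"
  shows "set_encode S < 2 ^ k"
proof -
  have "set_encode S \<le> (\<Sum>j<k. 2 ^ j)"
    unfolding set_encode_def using assms by (intro sum_mono2) auto
  also have "\<dots> < 2 ^ k" by (induction k) auto
  finally show ?thesis .
qed

lemma power_le_set_encode:
  assumes "finite S" "j \<in> S"
  shows "2 ^ j \<le> set_encode S"
  unfolding set_encode_def using assms by (intro member_le_sum) auto

lemma set_encode_remove:
  assumes "finite S" "j \<in> S"
  shows "set_encode S = 2 ^ j + set_encode (S - {j})"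
  using set_encode_insert[of "S - {j}" j] assms by (simp add: insert_absorb)

text \<open>The leading binary digit decides.\<close>

lemma set_encode_less_if_Max_less:
  assumes "finite S" "finite T" "S \<noteq> {}" "T \<noteq> {}" "Max S < Max T"
  shows "set_encode S < set_encode T"
proof -
  have "S \<subseteq> {..<Suc (Max S)}" using assms(1) by (auto simp: less_Suc_eq_le)
  then have "set_encode S < 2 ^ Suc (Max S)" by (rule set_encode_less_power)
  also have "\<dots> \<le> 2 ^ Max T" using assms(5) by (intro power_increasing) auto
  also have "\<dots> \<le> set_encode T" using assms by (intro power_le_set_encode) auto
  finally show ?thesis .
qed

text \<open>The levels are before, inside and after the interval with index \<open>s\<close>. Only
  \<open>A\<close> meets the inside, so the longest pattern is B A B.\<close>

lemma noncrossing_div: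
  assumes "\<And>x. x \<in> A \<Longrightarrow> x div L = s" "\<And>x. x \<in> B \<Longrightarrow> x div L \<noteq> s" "2 \<le> m"
  shows "noncrossing m A (B :: nat set)"
proof (rule noncrossing_monotone_levels
    [where f = "\<lambda>x. if x div L < s then 0 else if x div L = s then 1 else 2"])
  fix x y :: nat assume "x \<le> y"
  then have "x div L \<le> y div L" by (rule div_le_mono)
  then show "(if x div L < s then 0 else if x div L = s then 1 else 2)
    \<le> (if y div L < s then 0 else if y div L = s then 1 else (2::nat))" by auto
qed (use assms in \<open>auto split: if_splits\<close>)

text \<open>
  The order of \<open>set_encode\<close> is the colexicographic order on finite sets. Cutting the naturals into
  intervals of length \<open>L\<close>, the block of \<open>S\<close> lies in the interval with index \<open>set_encode S\<close> and the
  spine vertex \<open>j\<close> at the start of the one with index \<open>2 ^ j = set_encode {j}\<close>, so that \<open>div L\<close> tells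
  them apart as long as \<open>S\<close> has at least two elements.
\<close>

definition spine_pos :: "nat \<Rightarrow> nat \<Rightarrow> nat" where
  "spine_pos L j = L * 2 ^ j"

definition block_pos :: "nat \<Rightarrow> nat set \<Rightarrow> nat \<Rightarrow> nat" where
  "block_pos L S x = L * set_encode S + x"

definition page :: "nat \<Rightarrow> nat set \<Rightarrow> nat \<Rightarrow> nat set" where
  "page L S v = insert (block_pos L S v) (spine_pos L ` S)"

lemma spine_pos_div: "0 < L \<Longrightarrow> spine_pos L j div L = 2 ^ j"
  by (simp add: spine_pos_def)

lemma block_pos_div: "x < L \<Longrightarrow> block_pos L S x div L = set_encode S"
  by (simp add: block_pos_def)

lemma strict_mono_spine_pos: "0 < L \<Longrightarrow> strict_mono (spine_pos L)"
  by (auto simp: strict_mono_def spine_pos_def)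

lemma strict_mono_block_pos: "strict_mono (block_pos L S)"
  by (auto simp: strict_mono_def block_pos_def)

lemma inj_spine_pos: "0 < L \<Longrightarrow> inj (spine_pos L)"
  by (rule strict_mono_imp_inj_on[OF strict_mono_spine_pos])

lemma block_pos_less:
  assumes "x < L" "set_encode S < set_encode T"
  shows "block_pos L S x < block_pos L T y"
proof -
  have "block_pos L S x < L * Suc (set_encode S)" using assms by (simp add: block_pos_def)
  also have "\<dots> \<le> L * set_encode T" using assms by (intro mult_le_mono) auto
  finally show ?thesis by (simp add: block_pos_def)
qed

lemma spine_pos_less_block_pos:
  assumes "finite S" "j \<in> S" "0 < x"
  shows "spine_pos L j < block_pos L S x"
proof -
  have "L * 2 ^ j \<le> L * set_encode S" using power_le_set_encode[OF assms(1,2)] by (rule mult_le_mono2)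
  then show ?thesis unfolding spine_pos_def block_pos_def using assms(3) by linarith
qed

text \<open>Together with \<open>spine_pos_less_block_pos\<close>, this puts a block after the spine
  vertices of its \<open>S\<close> and before all larger spine vertices.\<close>

lemma block_pos_less_spine_pos:
  assumes "S \<subseteq> {..<j}" "x < L"
  shows "block_pos L S x < spine_pos L j"
proof -
  have "block_pos L S x < L * Suc (set_encode S)" using assms by (simp add: block_pos_def)
  also have "\<dots> \<le> L * 2 ^ j"
    using set_encode_less_power[OF assms(1)] by (intro mult_le_mono) auto
  finally show ?thesis by (simp add: spine_pos_def)
qed

text \<open>Offset 0 in an interval is reserved for the spine; this is why 0 is kept out of the
  vertex sets.\<close>

lemma spine_pos_neq_block_pos:
  assumes "x \<in> {1..<L}" shows "spine_pos L j \<noteq> block_pos L S x"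
proof
  assume "spine_pos L j = block_pos L S x"
  then have "spine_pos L j mod L = block_pos L S x mod L" by simp
  then show False using assms by (simp add: spine_pos_def block_pos_def)
qed

text \<open>A power of two encodes a singleton. As \<open>d \<ge> 3\<close>, the sets
  \<open>S\<close> of the construction have at least two elements, so no spine vertex shares an
  interval with a block.\<close>

lemma set_encode_neq_power:
  assumes "finite S" "2 \<le> card S" shows "set_encode S \<noteq> 2 ^ j"
proof
  assume "set_encode S = 2 ^ j"
  then have "set_encode S = set_encode {j}" by simp
  then have "S = {j}" using assms(1) by (metis finite.emptyI finite.insertI set_encode_eq)
  then show False using assms(2) by simp
qed

lemma finite_page [simp]: "finite S \<Longrightarrow> finite (page L S v)"
  by (simp add: page_def)

lemma card_page:
  assumes "finite S" "v \<in> {1..<L}"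
  shows "card (page L S v) = Suc (card S)"
proof -
  have "block_pos L S v \<notin> spine_pos L ` S" using spine_pos_neq_block_pos[OF assms(2)] by (metis imageE)
  then show ?thesis using assms inj_spine_pos[of L]
    by (simp add: page_def card_image inj_on_subset)
qed

section \<open>Alternations between edges of the construction\<close>

text \<open>The spine vertices of the page precede the block, in which the page has only its last
  vertex. The longest pattern is spine, block edge, that vertex, block edge: three
  alternations.\<close>

lemma noncrossing_block_page_same:
  assumes "finite S" "v < L" "A \<subseteq> block_pos L S ` {1..<L}" "3 \<le> m"
  shows "noncrossing m A (page L S v)"
proof (rule noncrossing_monotone_levels
    [where f = "\<lambda>x. if x \<le> L * set_encode S then 0 else if x < block_pos L S v then 1
       else if x = block_pos L S v then 2 else 3"])
  fix x y assume x: "x \<in> A" and y: "y \<in> page L S v"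
  have "L * set_encode S < x" using x assms(3) by (auto simp: block_pos_def)
  moreover have "spine_pos L j \<le> L * set_encode S" if "j \<in> S" for j
    using power_le_set_encode[OF assms(1) that] by (simp add: spine_pos_def)
  then have "y \<le> L * set_encode S \<or> y = block_pos L S v" using y by (auto simp: page_def)
  ultimately show
    "(if x \<le> L * set_encode S then 0 else if x < block_pos L S v then 1
       else if x = block_pos L S v then 2 else 3) =
     (if y \<le> L * set_encode S then 0 else if y < block_pos L S v then 1
       else if y = block_pos L S v then 2 else (3::nat)) \<Longrightarrow> x = y"
    by (auto split: if_splits)
qed (use assms(4) in auto)

text \<open>The page of another set \<open>T\<close> misses the interval of \<open>S\<close>: its
  block vertex lies in the interval of \<open>T\<close>, its spine vertices in intervals indexed by
  powers of two.\<close>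

lemma noncrossing_block_page:
  assumes "finite S" "finite T" "2 \<le> card S" "v < L" "A \<subseteq> block_pos L S ` {1..<L}" "3 \<le> m"
  shows "noncrossing m A (page L T v)"
proof (cases "S = T")
  case True
  then show ?thesis using assms noncrossing_block_page_same by blast
next
  case False
  then have neq: "set_encode T \<noteq> set_encode S" using assms by (simp add: set_encode_eq)
  show ?thesis
  proof (rule noncrossing_div[where L = L and s = "set_encode S"])
    show "x div L = set_encode S" if "x \<in> A" for x
      using that assms(5) by (auto simp: block_pos_div)
    show "x div L \<noteq> set_encode S" if "x \<in> page L T v" for x
    proof -
      have "2 ^ j \<noteq> set_encode S" for j using set_encode_neq_power[OF assms(1,3)] by metis
      then show ?thesis
        using that assms(4) neq by (auto simp: page_def block_pos_div spine_pos_div)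
    qed
  qed (use assms in auto)
qed

lemma noncrossing_block_block:
  assumes "finite S" "finite T" "A \<subseteq> {1..<L}" "B \<subseteq> {1..<L}" "3 \<le> m" "noncrossing m A B"
  shows "noncrossing m (block_pos L S ` A) (block_pos L T ` B)"
proof (cases "S = T")
  case True
  then show ?thesis using noncrossing_image[OF assms(6) strict_mono_block_pos] by simp
next
  case False
  then have neq: "set_encode T \<noteq> set_encode S" using assms by (simp add: set_encode_eq)
  show ?thesis
    by (rule noncrossing_div[where L = L and s = "set_encode S"])
      (use assms neq in \<open>auto simp: block_pos_div subset_iff\<close>)
qed

text \<open>Colexicographic order compares largest elements first. If these differ,
  \<open>noncrossing_two_pairs\<close> applies to the ends of both pages. If they agree, either a
  second common spine vertex makes the union small, or the pages meet in one point and the second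
  largest elements decide.\<close>

lemma noncrossing_page_page_less:
  assumes d: "3 \<le> d" and S: "finite S" "card S = d - 1" and T: "finite T" "card T = d - 1"
    and less: "set_encode S < set_encode T" and v: "v \<in> {1..<L}" and w: "w \<in> {1..<L}"
  shows "noncrossing (2 * d - 3) (page L S v) (page L T w)"
proof -
  have L: "0 < L" using v by simp
  note mono = strict_mono_less[OF strict_mono_spine_pos[OF L]]
    strict_mono_less_eq[OF strict_mono_spine_pos[OF L]]
  have ne: "S \<noteq> {}" "T \<noteq> {}" using d S T by auto
  have card: "card (page L S v) = d" "card (page L T w) = d"
    using card_page S T v w d by auto
  have vw: "block_pos L S v < block_pos L T w" using v less by (intro block_pos_less) auto
  have vT: "block_pos L S v \<notin> page L T w"
    using vw spine_pos_neq_block_pos[OF v] unfolding page_def by (metis imageE insertE less_irrefl)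
  have wS: "block_pos L T w \<notin> page L S v"
    using vw spine_pos_neq_block_pos[OF w] unfolding page_def by (metis imageE insertE less_irrefl)
  have beyond: "block_pos L S v \<le> spine_pos L j" if "Max S < j" for j
  proof -
    have "S \<subseteq> {..<j}" using Max_ge[OF S(1)] that by (metis lessThan_iff order_le_less_trans subsetI)
    then show ?thesis using block_pos_less_spine_pos v by (simp add: less_imp_le)
  qed
  have spineT: "spine_pos L j < block_pos L T w" if "j \<le> Max T" for j
  proof -
    have "spine_pos L j \<le> spine_pos L (Max T)" using mono that by simp
    also have "\<dots> < block_pos L T w" using T ne w by (intro spine_pos_less_block_pos) auto
    finally show ?thesis .
  qed
  have spineS: "spine_pos L (Max S) < block_pos L S v"
    using S ne v by (intro spine_pos_less_block_pos) auto
  have memS: "spine_pos L j \<in> page L S x \<longleftrightarrow> j \<in> S" if "x \<in> {1..<L}" for j S x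
    using inj_spine_pos[OF L] spine_pos_neq_block_pos[OF that] by (auto simp: page_def inj_image_mem_iff)
  have "\<not> Max T < Max S"
    using set_encode_less_if_Max_less[of T S] S T ne less by auto
  then consider "Max S < Max T" | "Max S = Max T" by linarith
  then show ?thesis
  proof cases
    case 1
    have "Max T \<notin> S" using 1 S(1) by (meson Max_ge leD)
    show ?thesis
    \<comment> \<open>The last two vertices of \<open>page L S v\<close> are neighbours in the
      union, and those of \<open>page L T w\<close> are its top two.\<close>
    proof (rule noncrossing_two_pairs[where p = "spine_pos L (Max S)" and v = "block_pos L S v"
          and q = "spine_pos L (Max T)" and w = "block_pos L T w"])
      fix x assume x: "x \<in> page L S v \<union> page L T w"
      show "x \<le> spine_pos L (Max S) \<or> block_pos L S v \<le> x"
      proof -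
        have "x = block_pos L S v \<or> x = block_pos L T w \<or> (\<exists>j. x = spine_pos L j)"
          using x by (auto simp: page_def)
        then show ?thesis using vw beyond by (metis mono(2) leI less_imp_le order_refl)
      qed
      have "x \<le> spine_pos L (Max T)" if "j \<in> S \<union> T" "x = spine_pos L j" for j
        using that S T 1 by (auto simp: mono dest: Max_ge[rotated] intro: order_trans less_imp_le)
      moreover have "block_pos L S v \<le> spine_pos L (Max T)" using 1 by (rule beyond)
      ultimately show "x \<le> spine_pos L (Max T) \<or> x = block_pos L T w"
        using x by (auto simp: page_def)
    qed (use S T v w ne card vT wS spineS spineT memS \<open>Max T \<notin> S\<close> in \<open>auto simp: page_def\<close>)
  next
    case 2
    let ?m = "Max T"
    have m: "?m \<in> S" "?m \<in> T" using 2 S T ne Max_in by metis+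
    show ?thesis
    proof (cases "S \<inter> T = {?m}")
      case False
      then have "{?m} \<subset> S \<inter> T" using m by blast
      then have "card {?m} < card (S \<inter> T)" using S by (intro psubset_card_mono) auto
      \<comment> \<open>Two common spine vertices leave at most 2d - 4 elements in
        \<open>S \<union> T\<close>, hence at most 2d - 2 points in the union of the pages.\<close>
      then have c: "2 \<le> card (S \<inter> T)" by simp
      have "page L S v \<union> page L T w
          = insert (block_pos L S v) (insert (block_pos L T w) (spine_pos L ` (S \<union> T)))"
        by (auto simp: page_def)
      then have "card (page L S v \<union> page L T w) \<le> 2 + card (S \<union> T)"
        using S T card_image_le[of "S \<union> T" "spine_pos L"]
        by (simp add: card_insert_if)
      also have "\<dots> \<le> Suc (2 * d - 3)"
        using card_Un_Int[OF S(1) T(1)] S T c d by simp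
      finally show ?thesis using S T by (intro noncrossing_if_card_Un) auto
    next
      case True
      let ?S = "S - {?m}" and ?T = "T - {?m}"
      have cST: "card ?S = d - 2" "card ?T = d - 2" using S T m by auto
      have "0 < card ?S" "0 < card ?T" using cST d by linarith+
      then have ne': "?S \<noteq> {}" "?T \<noteq> {}" unfolding card_gt_0_iff by blast+
      have inS: "Max ?S \<in> ?S" and inT: "Max ?T \<in> ?T"
        using Max_in[OF _ ne'(1)] Max_in[OF _ ne'(2)] S(1) T(1) by simp_all
      have "Max ?S \<noteq> Max ?T" using inS inT True by (metis DiffD1 DiffD2 IntI)
      \<comment> \<open>Removing the common maximum lowers both encodings by the same power of two,
        so their order is kept and the second largest elements are compared.\<close>
      moreover have "\<not> Max ?T < Max ?S"
        using set_encode_less_if_Max_less[of ?T ?S] S T ne' less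
          set_encode_remove[OF S(1) m(1)] set_encode_remove[OF T(1) m(2)] by auto
      ultimately have second: "Max ?S < Max ?T" by simp
      have le: "j \<le> Max ?T \<or> j = ?m" if "j \<in> S \<union> T" for j
      proof -
        have "j \<le> Max ?S" if "j \<in> ?S" using that S by (intro Max_ge) auto
        moreover have "j \<le> Max ?T" if "j \<in> ?T" using that T by (intro Max_ge) auto
        ultimately show ?thesis using that second by fastforce
      qed
      have ltm: "Max ?T < ?m" using inT T(1) by (metis DiffD1 DiffD2 Max_ge insertI1 order_le_less)
      show ?thesis
      \<comment> \<open>The union ends with the spine vertices of \<open>Max ?T\<close> and
        \<open>?m\<close>, followed by the two block vertices, that of \<open>S\<close>
        first.\<close>
      proof (rule noncrossing_common_point[where p = "spine_pos L ?m" and v = "block_pos L S v"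
            and q = "spine_pos L (Max ?T)" and w = "block_pos L T w"])
        show "page L S v \<inter> page L T w = {spine_pos L ?m}"
        proof (intro equalityI subsetI)
          fix x assume x: "x \<in> page L S v \<inter> page L T w"
          then have "x \<noteq> block_pos L S v" using vT by blast
          then obtain j where "j \<in> S" "x = spine_pos L j" using x by (auto simp: page_def)
          then have "j \<in> S \<inter> T" using x memS[OF w] by blast
          then show "x \<in> {spine_pos L ?m}" using \<open>x = spine_pos L j\<close> True by auto
        qed (use m memS v w in auto)
        fix x assume x: "x \<in> page L S v \<union> page L T w"
        have sp: "\<exists>j\<in>S \<union> T. x = spine_pos L j" if "x \<noteq> block_pos L S v" "x \<noteq> block_pos L T w"
          using x that by (auto simp: page_def)
        have mv: "spine_pos L ?m < block_pos L S v" using spineS 2 by simp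
        show "x \<le> spine_pos L (Max ?T) \<or> spine_pos L ?m \<le> x"
          using sp le mv vw by (metis mono(2) order.refl less_imp_le order_trans)
        show "x \<le> spine_pos L ?m \<or> block_pos L S v \<le> x"
          using sp le ltm vw by (metis mono(2) order.refl less_imp_le order_trans)
        show "x \<le> block_pos L T w"
        proof -
          have "j \<le> ?m" if "j \<in> S \<union> T" for j using le[OF that] ltm by auto
          then show ?thesis using sp vw spineT by (metis order.refl less_imp_le)
        qed
      qed (use S T v w card vw inT ltm spineS 2 memS mono in \<open>auto simp: page_def\<close>)
    qed
  qed
qed

lemma noncrossing_page_page:
  assumes d: "3 \<le> d" and S: "finite S" "card S = d - 1" and T: "finite T" "card T = d - 1"
    and v: "v \<in> {1..<L}" and w: "w \<in> {1..<L}"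
  shows "noncrossing (2 * d - 3) (page L S v) (page L T w)"
proof (cases "S = T")
  case True
  \<comment> \<open>Two pages on the same spine vertices have at most d + 1 points together, and
    \<open>d + 1 \<le> 2 * d - 2\<close> because \<open>d \<ge> 3\<close>.\<close>
  have "page L S v \<union> page L S w = insert (block_pos L S w) (page L S v)" by (auto simp: page_def)
  then have "card (page L S v \<union> page L S w) \<le> Suc d"
    using S d card_page[OF S(1) v] by (simp add: card_insert_if)
  then show ?thesis using True S d by (intro noncrossing_if_card_Un) auto
next
  case False
  then have "set_encode S \<noteq> set_encode T" using S T by (simp add: set_encode_eq)
  then consider "set_encode S < set_encode T" | "set_encode T < set_encode S" by linarith
  then show ?thesis
  proof cases
    case 1
    then show ?thesis by (rule noncrossing_page_page_less[OF d S T _ v w])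
  next
    case 2
    then show ?thesis by (rule noncrossing_sym[OF noncrossing_page_page_less[OF d T S _ w v]])
  qed
qed

section \<open>Forcing many colours by induction\<close>

lemma pigeonhole_fiber:
  fixes f :: "'a \<Rightarrow> 'b"
  assumes "finite A" "card (f ` A) * k < card A"
  shows "\<exists>y. k < card {x\<in>A. f x = y}"
proof (rule ccontr)
  assume "\<nexists>y. k < card {x\<in>A. f x = y}"
  then have "(\<Sum>y\<in>f ` A. card {x\<in>A. f x = y}) \<le> (\<Sum>y\<in>f ` A. k)"
    by (intro sum_mono) (simp add: not_less)
  moreover have "card A = (\<Sum>y\<in>f ` A. card {x\<in>A. f x = y})"
    using sum.image_gen[OF assms(1), of "\<lambda>_. 1::nat" f] by simp
  ultimately show False using assms(2) by simp
qed

text \<open>The last conjunct counts the colours used on \<open>V\<close>, whatever the palette, so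
  that a copy inside a larger hypergraph with few colours is forced to use all of them.\<close>

lemma noncrossing_hypergraph_many_colors:
  assumes d: "3 \<le> d"
  shows "\<exists>V E. finite V \<and> 0 \<notin> V \<and> V \<noteq> {} \<and> card V \<le> (c * d) ^ (d * c)
    \<and> (\<forall>e\<in>E. e \<subseteq> V \<and> card e = d) \<and> (\<forall>e\<in>E. \<forall>e'\<in>E. noncrossing (2 * d - 3) e e')
    \<and> (\<forall>\<kappa> :: nat \<Rightarrow> nat. (\<forall>e\<in>E. 1 < card (\<kappa> ` e)) \<longrightarrow> c < card (\<kappa> ` V))"
proof (induction c)
  case 0
  \<comment> \<open>One vertex without edges; the bound on the number of vertices reads
    \<open>0 ^ 0 = 1\<close>.\<close>
  show ?case by (intro exI[of _ "{1}"] exI[of _ "{}"]) auto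
next
  case (Suc c)
  then obtain V E where V: "finite V" "0 \<notin> V" "V \<noteq> {}" "card V \<le> (c * d) ^ (d * c)"
    and E: "\<And>e. e \<in> E \<Longrightarrow> e \<subseteq> V" "\<And>e. e \<in> E \<Longrightarrow> card e = d"
    and nc: "\<And>e e'. e \<in> E \<Longrightarrow> e' \<in> E \<Longrightarrow> noncrossing (2 * d - 3) e e'"
    and col: "\<And>\<kappa> :: nat \<Rightarrow> nat. (\<forall>e\<in>E. 1 < card (\<kappa> ` e)) \<Longrightarrow> c < card (\<kappa> ` V)"
    by (elim exE conjE) (metis (no_types, lifting))
  \<comment> \<open>Room for the offsets 1 to \<open>Max V\<close>, with 0 left to the
    spine.\<close>
  define L where "L = Suc (Max V)"
  have VL: "V \<subseteq> {1..<L}"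
    using V by (auto simp: L_def less_Suc_eq_le Suc_le_eq intro: gr0I)
  then have L: "0 < L" using V by auto
  \<comment> \<open>One more than \<open>Suc c\<close> colours can cover if each is used on at most
    d - 2 spine vertices.\<close>
  define M where "M = Suc c * (d - 2) + 1"
  define \<S> where "\<S> = {S. S \<subseteq> {..<M} \<and> card S = d - 1}"
  have \<S>: "finite S" "card S = d - 1" "2 \<le> card S" if "S \<in> \<S>" for S
    using that d finite_subset by (auto simp: \<S>_def)
  have fin\<S>: "finite \<S>" unfolding \<S>_def by simp
  define V' where "V' = spine_pos L ` {..<M} \<union> (\<Union>S\<in>\<S>. block_pos L S ` V)"
  define E1 where "E1 = (\<Union>S\<in>\<S>. (`) (block_pos L S) ` E)"
  define E2 where "E2 = (\<Union>S\<in>\<S>. page L S ` V)"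
  have E1: "\<exists>S\<in>\<S>. \<exists>a\<in>E. e = block_pos L S ` a" if "e \<in> E1" for e using that by (auto simp: E1_def)
  have E2: "\<exists>S\<in>\<S>. \<exists>v\<in>V. e = page L S v" if "e \<in> E2" for e using that by (auto simp: E2_def)
  have m3: "3 \<le> 2 * d - 3" using d by simp
  have nc11: "noncrossing (2 * d - 3) e e'" if "e \<in> E1" "e' \<in> E1" for e e'
  proof -
    obtain S a where S: "S \<in> \<S>" "a \<in> E" "e = block_pos L S ` a" using E1[OF \<open>e \<in> E1\<close>] by blast
    obtain T b where T: "T \<in> \<S>" "b \<in> E" "e' = block_pos L T ` b" using E1[OF \<open>e' \<in> E1\<close>] by blast
    have "a \<subseteq> {1..<L}" "b \<subseteq> {1..<L}" using E(1)[OF S(2)] E(1)[OF T(2)] VL by auto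
    then show ?thesis unfolding S(3) T(3)
      using \<S>(1)[OF S(1)] \<S>(1)[OF T(1)] m3 nc[OF S(2) T(2)] by (intro noncrossing_block_block) auto
  qed
  have nc12: "noncrossing (2 * d - 3) e e'" if "e \<in> E1" "e' \<in> E2" for e e'
  proof -
    obtain S a where S: "S \<in> \<S>" "a \<in> E" "e = block_pos L S ` a" using E1[OF \<open>e \<in> E1\<close>] by blast
    obtain T v where T: "T \<in> \<S>" "v \<in> V" "e' = page L T v" using E2[OF \<open>e' \<in> E2\<close>] by blast
    have "a \<subseteq> {1..<L}" using E(1)[OF S(2)] VL by (rule subset_trans)
    then show ?thesis unfolding S(3) T(3)
      using \<S>[OF S(1)] \<S>[OF T(1)] T VL m3 by (intro noncrossing_block_page[where S = S]) auto
  qed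
  have nc22: "noncrossing (2 * d - 3) e e'" if "e \<in> E2" "e' \<in> E2" for e e'
  proof -
    obtain S v where S: "S \<in> \<S>" "v \<in> V" "e = page L S v" using E2[OF \<open>e \<in> E2\<close>] by blast
    obtain T w where T: "T \<in> \<S>" "w \<in> V" "e' = page L T w" using E2[OF \<open>e' \<in> E2\<close>] by blast
    show ?thesis unfolding S(3) T(3)
      using \<S>[OF S(1)] \<S>[OF T(1)] S T VL d by (intro noncrossing_page_page) auto
  qed
  \<comment> \<open>With K = (c + 1)d there are at most K^(d-1) blocks, each of at most K^(dc)
    vertices, and at most K spine vertices. One further factor K absorbs the 2 from adding the two
    bounds.\<close>
  have "card V' \<le> (Suc c * d) ^ (d * Suc c)"
  proof -
    let ?K = "Suc c * d"
    have MK: "M \<le> ?K"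
    proof -
      have "Suc c * (d - 2) + Suc c * 2 = ?K" using d by (metis Suc_leD add_diff_inverse_nat add.commute distrib_left not_less numeral_3_eq_3 numeral_2_eq_2)
      moreover have "M \<le> Suc c * (d - 2) + Suc c * 2" unfolding M_def by (rule add_left_mono) simp
      ultimately show ?thesis by simp
    qed
    have K: "2 \<le> ?K" using d by simp
    have "card \<S> = M choose (d - 1)"
      unfolding \<S>_def using n_subsets[of "{..<M}" "d - 1"] by simp
    also have "\<dots> \<le> M ^ (d - 1)"
      by (cases "d - 1 \<le> M") (auto simp: binomial_le_pow binomial_eq_0)
    also have "\<dots> \<le> ?K ^ (d - 1)" using MK by (rule power_mono) simp
    finally have c\<S>: "card \<S> \<le> ?K ^ (d - 1)" .
    have cV: "card V \<le> ?K ^ (d * c)"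
      using V(4) by (rule order_trans) (intro power_mono, auto)
    let ?P = "?K ^ (d - 1) * ?K ^ (d * c)"
    have "card (\<Union>S\<in>\<S>. block_pos L S ` V) \<le> (\<Sum>S\<in>\<S>. card (block_pos L S ` V))"
      using fin\<S> by (rule card_UN_le)
    also have "\<dots> \<le> (\<Sum>S\<in>\<S>. card V)" using V by (intro sum_mono card_image_le) auto
    also have "\<dots> = card \<S> * card V" by simp
    also have "\<dots> \<le> ?P" using c\<S> cV by (rule mult_le_mono)
    finally have blocks: "card (\<Union>S\<in>\<S>. block_pos L S ` V) \<le> ?P" .
    have "?K ^ 1 \<le> ?K ^ (d - 1 + d * c)" using K d by (intro power_increasing) auto
    then have "?K \<le> ?P" by (simp only: power_add power_one_right)
    moreover have "card (spine_pos L ` {..<M}) \<le> M"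
      using card_image_le[of "{..<M}" "spine_pos L"] by simp
    moreover have "card V' \<le> card (spine_pos L ` {..<M}) + card (\<Union>S\<in>\<S>. block_pos L S ` V)"
      unfolding V'_def by (rule card_Un_le)
    ultimately have "card V' \<le> 2 * ?P" using blocks MK by linarith
    also have "\<dots> \<le> ?K * (?K ^ (d - 1) * ?K ^ (d * c))" using K by (intro mult_le_mono) auto
    also have "\<dots> = ?K ^ (Suc (d - 1) + d * c)" by (simp only: power_add power_Suc mult.assoc)
    also have "Suc (d - 1) + d * c = d * Suc c" using d by simp
    finally show ?thesis .
  qed
  moreover have "0 \<notin> V'" using VL L by (auto simp: V'_def spine_pos_def block_pos_def)
  moreover have "finite V'" using V fin\<S> by (auto simp: V'_def)
  moreover have "V' \<noteq> {}" by (auto simp: V'_def M_def)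
  moreover have "e \<subseteq> V' \<and> card e = d" if "e \<in> E1 \<union> E2" for e
    using that
  proof
    assume "e \<in> E1"
    then obtain S a where S: "S \<in> \<S>" "a \<in> E" "e = block_pos L S ` a" using E1 by blast
    then have "e \<subseteq> V'" using E(1)[OF S(2)] by (auto simp: V'_def)
    moreover have "inj_on (block_pos L S) a"
      using strict_mono_imp_inj_on[OF strict_mono_block_pos] inj_on_subset by blast
    ultimately show ?thesis using S E(2) by (simp add: card_image)
  next
    assume "e \<in> E2"
    then obtain S v where S: "S \<in> \<S>" "v \<in> V" "e = page L S v" using E2 by blast
    then have "e \<subseteq> V'" by (auto simp: V'_def page_def \<S>_def)
    moreover have "card e = d" using S card_page[of S v L] \<S>[OF S(1)] VL d by auto
    ultimately show ?thesis by blast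
  qed
  moreover have "Suc c < card (\<kappa> ` V')" if \<kappa>: "\<forall>e\<in>E1 \<union> E2. 1 < card (\<kappa> ` e)" for \<kappa> :: "nat \<Rightarrow> nat"
  proof (rule ccontr)
    assume "\<not> Suc c < card (\<kappa> ` V')"
    then have few: "card (\<kappa> ` V') \<le> Suc c" by simp
    have sub: "(\<lambda>j. \<kappa> (spine_pos L j)) ` {..<M} \<subseteq> \<kappa> ` V'" by (auto simp: V'_def)
    have "card ((\<lambda>j. \<kappa> (spine_pos L j)) ` {..<M}) \<le> Suc c"
      using card_mono[OF _ sub] \<open>finite V'\<close> few by simp
    then have "card ((\<lambda>j. \<kappa> (spine_pos L j)) ` {..<M}) * (d - 2) < card {..<M}"
      unfolding M_def by (simp only: card_lessThan) (metis less_add_one mult_le_mono1 order_le_less_trans)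
    then obtain y where "d - 2 < card {j\<in>{..<M}. \<kappa> (spine_pos L j) = y}"
      using pigeonhole_fiber[of "{..<M}"] by blast
    then have "d - 1 \<le> card {j\<in>{..<M}. \<kappa> (spine_pos L j) = y}" by simp
    then obtain S where S: "S \<subseteq> {j\<in>{..<M}. \<kappa> (spine_pos L j) = y}" "card S = d - 1"
      by (meson obtain_subset_with_card_n)
    then have S\<S>: "S \<in> \<S>" by (auto simp: \<S>_def)
    have "S \<noteq> {}" using S d by auto
    have "\<forall>e\<in>E. 1 < card ((\<kappa> \<circ> block_pos L S) ` e)"
    proof
      fix e assume "e \<in> E"
      then have "block_pos L S ` e \<in> E1 \<union> E2" using S\<S> by (auto simp: E1_def)
      then show "1 < card ((\<kappa> \<circ> block_pos L S) ` e)" using \<kappa> unfolding image_comp[symmetric] by blast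
    qed
    \<comment> \<open>The block of \<open>S\<close> has at least as many colours as all of
      \<open>V'\<close>, so it has every one of them, in particular the colour \<open>y\<close>
      shared by the spine vertices in \<open>S\<close>.\<close>
    then have "c < card ((\<kappa> \<circ> block_pos L S) ` V)" by (rule col)
    then have "card (\<kappa> ` V') \<le> card ((\<kappa> \<circ> block_pos L S) ` V)" using few by simp
    moreover have "(\<kappa> \<circ> block_pos L S) ` V \<subseteq> \<kappa> ` V'" using S\<S> by (auto simp: V'_def)
    ultimately have "(\<kappa> \<circ> block_pos L S) ` V = \<kappa> ` V'"
      using \<open>finite V'\<close> by (meson card_seteq finite_imageI)
    moreover have "y \<in> \<kappa> ` V'"
    proof -
      obtain j where "j \<in> S" using \<open>S \<noteq> {}\<close> by blast
      then have "j < M" "\<kappa> (spine_pos L j) = y" using S by auto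
      then show ?thesis by (auto simp: V'_def)
    qed
    ultimately have "y \<in> (\<kappa> \<circ> block_pos L S) ` V" by simp
    then obtain v where v: "v \<in> V" "\<kappa> (block_pos L S v) = y" by auto
    have "\<kappa> ` page L S v \<subseteq> {y}" using S v by (auto simp: page_def)
    then have "card (\<kappa> ` page L S v) \<le> 1" using card_mono[of "{y}"] by simp
    moreover have "page L S v \<in> E1 \<union> E2" using S\<S> v by (auto simp: E2_def)
    ultimately show False using \<kappa> by (meson not_less)
  qed
  moreover have "noncrossing (2 * d - 3) e e'" if "e \<in> E1 \<union> E2" "e' \<in> E1 \<union> E2" for e e'
    using that nc11 nc12 nc22 noncrossing_sym by blast
  ultimately show ?case by (intro exI[of _ V'] exI[of _ "E1 \<union> E2"]) blast
qed

subsection \<open>Weak chromatic numbers of embeddable hypergraphs\<close>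

text \<open>An injective colouring is proper since edges have at least two vertices. So the least
  number of colours is attained, and an optimal colouring must itself use more than \<open>c\<close>
  colours.\<close>

lemma less_weak_chromatic_number:
  assumes V: "finite V" and E: "\<And>e. e \<in> E \<Longrightarrow> e \<subseteq> V" "\<And>e. e \<in> E \<Longrightarrow> 1 < card e"
    and many: "\<And>\<kappa> :: 'v \<Rightarrow> nat. \<forall>e\<in>E. 1 < card (\<kappa> ` e) \<Longrightarrow> c < card (\<kappa> ` V)"
  shows "c < weak_chromatic_number V E"
proof -
  obtain h :: "'v \<Rightarrow> nat" where h: "bij_betw h V {1..card V}"
    using V ex_bij_betw_nat_finite_1 bij_betw_inv by blast
  have "1 < card (h ` e)" if "e \<in> E" for e
  proof -
    have "inj_on h e" using h E(1)[OF that] inj_on_subset by (auto simp: bij_betw_def)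
    then show ?thesis using E(2)[OF that] by (simp add: card_image)
  qed
  then have "weak_coloring V E (card V) h"
    using h unfolding weak_coloring_def by (auto simp: bij_betw_def)
  then have "\<exists>\<kappa>. weak_coloring V E (weak_chromatic_number V E) \<kappa>"
    unfolding weak_chromatic_number_def
    by (intro LeastI[where P = "\<lambda>c. \<exists>\<kappa>. weak_coloring V E c \<kappa>"] exI)
  then obtain \<kappa> where \<kappa>: "weak_coloring V E (weak_chromatic_number V E) \<kappa>" ..
  then have "c < card (\<kappa> ` V)" by (intro many) (auto simp: weak_coloring_def)
  also have "\<kappa> ` V \<subseteq> {1..weak_chromatic_number V E}" using \<kappa> by (auto simp: weak_coloring_def)
  then have "card (\<kappa> ` V) \<le> weak_chromatic_number V E" using card_mono[of "{1..weak_chromatic_number V E}"] by simp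
  finally show ?thesis .
qed

lemma embeddable_if_noncrossing:
  fixes h :: "nat \<Rightarrow> 'v"
  assumes n: "CARD('n::finite) = m" and h: "inj_on h V" and "finite V" and k: "k \<le> Suc m"
    and E: "\<And>e. e \<in> E \<Longrightarrow> e \<subseteq> V" "\<And>e. e \<in> E \<Longrightarrow> card e = k"
    and nc: "\<And>e e'. e \<in> E \<Longrightarrow> e' \<in> E \<Longrightarrow> noncrossing m e e'"
  shows "embeddable k W ((`) h ` E) TYPE(real ^ 'n)"
proof -
  obtain \<iota> :: "'n \<Rightarrow> nat" where "bij_betw \<iota> UNIV {0..<CARD('n)}"
    using ex_bij_betw_finite_nat[of "UNIV :: 'n set"] by auto
  then have \<iota>: "range \<iota> = {..<CARD('n)}" by (auto simp: bij_betw_def atLeast0LessThan)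
  let ?g = "moment_curve \<iota>"
  \<comment> \<open>The order lives on \<open>V\<close>, so the renaming \<open>h\<close> is undone
    before passing to the curve. Outside the image of \<open>V\<close> under \<open>h\<close> the
    value is arbitrary, and no edge reaches there.\<close>
  define \<phi> where "\<phi> = (\<lambda>i. ?g (real (inv_into V h i)))"
  have \<phi>: "\<phi> ` h ` e = ?g ` real ` e" if "e \<subseteq> V" for e
    using h that by (auto simp: \<phi>_def image_image subset_iff intro!: image_cong)
  have fin: "finite e" if "e \<in> E" for e using E(1)[OF that] \<open>finite V\<close> by (rule finite_subset)
  have "aff_dim (\<phi> ` h ` e) = int k - 1" if "e \<in> E" for e
    using moment_curve_aff_dim[OF \<iota>, of "real ` e"] E that fin k n
    by (simp add: \<phi> card_image)
  moreover have "convex hull (\<phi> ` h ` e1) \<inter> convex hull (\<phi> ` h ` e2) = convex hull (\<phi> ` (h ` e1 \<inter> h ` e2))"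
    if e: "e1 \<in> E" "e2 \<in> E" for e1 e2
  proof -
    have "noncrossing m (real ` e1) (real ` e2)"
      using nc[OF e] by (rule noncrossing_image) (simp add: strict_mono_def)
    then have "convex hull (?g ` real ` e1) \<inter> convex hull (?g ` real ` e2)
        = convex hull (?g ` (real ` e1 \<inter> real ` e2))"
      using moment_curve_convex_hull_Int[OF \<iota>, of "real ` e1" "real ` e2"] e fin n by simp
    moreover have "h ` e1 \<inter> h ` e2 = h ` (e1 \<inter> e2)"
      using inj_on_image_Int[OF h] E(1) e by simp
    moreover have "real ` e1 \<inter> real ` e2 = real ` (e1 \<inter> e2)" by auto
    moreover have "e1 \<inter> e2 \<subseteq> V" using E(1) e by blast
    ultimately show ?thesis using E(1) e by (simp add: \<phi>)
  qed
  ultimately have "linear_embedding k W ((`) h ` E) \<phi>"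
    unfolding linear_embedding_def by blast
  then show ?thesis unfolding embeddable_def by blast
qed

text \<open>With x = ln n, let c be the integer part of x / (d ln x). The bound on \<open>n\<close>
  gives ln x \<ge> 1, so c d \<le> x and therefore d c ln (c d) \<le> d c ln x \<le> x.\<close>

lemma ln_over_ln_ln_choice:
  assumes d: "0 < d" and n: "exp (exp 1) \<le> real n"
  shows "\<exists>c. (c * d) ^ (d * c) \<le> n \<and> ln (real n) / (real d * ln (ln (real n))) \<le> real (Suc c)"
proof -
  let ?x = "ln (real n)"
  have n0: "0 < real n" using n by (meson exp_gt_zero less_le_trans)
  have x: "exp 1 \<le> ?x" using n n0 by (simp add: ln_ge_iff)
  then have x0: "0 < ?x" by (meson exp_gt_zero less_le_trans)
  have y: "1 \<le> ln ?x" using x x0 by (simp add: ln_ge_iff)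
  define c where "c = nat \<lfloor>?x / (real d * ln ?x)\<rfloor>"
  have q: "0 \<le> ?x / (real d * ln ?x)" using x0 y by (intro divide_nonneg_nonneg mult_nonneg_nonneg) linarith+
  have "real c \<le> ?x / (real d * ln ?x)" using q unfolding c_def by linarith
  then have cx: "real d * real c * ln ?x \<le> ?x" using d y by (simp add: field_simps)
  have "(c * d) ^ (d * c) \<le> n"
  proof (cases "c = 0")
    case True
    then show ?thesis using n0 by simp
  next
    case False
    have pos: "0 < real (c * d)" using False d by simp
    have "real (c * d) \<le> real d * real c * ln ?x"
      using mult_left_mono[OF y, of "real d * real c"] by (simp add: mult.commute)
    then have "real (c * d) \<le> ?x" using cx by linarith
    then have "ln (real (c * d)) \<le> ln ?x" using pos x0 by simp
    then have "real d * real c * ln (real (c * d)) \<le> ?x"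
      using cx mult_left_mono[of "ln (real (c * d))" "ln ?x" "real d * real c"] by simp
    then have "ln (real ((c * d) ^ (d * c))) \<le> ?x"
      using pos by (simp only: of_nat_power ln_realpow of_nat_mult)
    then have "real ((c * d) ^ (d * c)) \<le> real n"
      using pos n0 by (subst (asm) ln_le_cancel_iff) auto
    then show ?thesis by (simp only: of_nat_le_iff)
  qed
  moreover have "?x / (real d * ln ?x) \<le> real (Suc c)" unfolding c_def by linarith
  ultimately show ?thesis by blast
qed

theorem mainTheorem17:
  fixes d :: nat
  assumes "d \<ge> 3"
    and "CARD('n::finite) = 2 * d - 3"
  shows "\<exists>c>0. \<exists>n0::nat. \<forall>n\<ge>n0. \<exists>E :: nat set set.
           uniform_hypergraph d {0..<n} E \<and>
           embeddable d {0..<n} E TYPE(real^'n) \<and>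
           real (weak_chromatic_number {0..<n} E) \<ge> c * ln (real n) / ln (ln (real n))"
proof (intro exI[of _ "1 / real d"] exI[of _ "nat \<lceil>exp (exp 1 :: real)\<rceil>"] conjI allI impI)
  show "0 < 1 / real d" using assms by simp
  fix n assume "nat \<lceil>exp (exp 1 :: real)\<rceil> \<le> n"
  then have "exp (exp 1) \<le> real n" by linarith
  then obtain c where c: "(c * d) ^ (d * c) \<le> n"
      "ln (real n) / (real d * ln (ln (real n))) \<le> real (Suc c)"
    using ln_over_ln_ln_choice[of d n] assms(1) by auto
  obtain V E where V: "finite V" "card V \<le> (c * d) ^ (d * c)"
    and E: "\<And>e. e \<in> E \<Longrightarrow> e \<subseteq> V" "\<And>e. e \<in> E \<Longrightarrow> card e = d"
    and nc: "\<And>e e'. e \<in> E \<Longrightarrow> e' \<in> E \<Longrightarrow> noncrossing (2 * d - 3) e e'"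
    and col: "\<And>\<kappa> :: nat \<Rightarrow> nat. \<forall>e\<in>E. 1 < card (\<kappa> ` e) \<Longrightarrow> c < card (\<kappa> ` V)"
    using noncrossing_hypergraph_many_colors[OF assms(1), of c] by (elim exE conjE) (metis (no_types, lifting))
  \<comment> \<open>The remaining vertices of \<open>{0..<n}\<close> stay isolated, which cannot
    reduce the number of colours used.\<close>
  obtain h where h: "h ` V \<subseteq> {0..<n}" "inj_on h V"
    using card_le_inj[OF V(1), of "{0..<n}"] V(2) c(1) by auto
  have card: "card (h ` e) = d" if "e \<in> E" for e
    using E[OF that] h(2) by (metis card_image inj_on_subset)
  let ?E = "(`) h ` E"
  have uniform: "uniform_hypergraph d {0..<n} ?E"
    using E(1) h(1) card unfolding uniform_hypergraph_def by blast
  have "c < weak_chromatic_number {0..<n} ?E"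
  proof (rule less_weak_chromatic_number)
    fix \<kappa> :: "nat \<Rightarrow> nat" assume "\<forall>e\<in>?E. 1 < card (\<kappa> ` e)"
    then have "c < card ((\<kappa> \<circ> h) ` V)" by (intro col) (auto simp: image_comp)
    also have "\<dots> \<le> card (\<kappa> ` {0..<n})" using h(1) by (intro card_mono) auto
    finally show "c < card (\<kappa> ` {0..<n})" .
  qed (use uniform assms(1) in \<open>auto simp: uniform_hypergraph_def\<close>)
  \<comment> \<open>The strict bound gives \<open>Suc c\<close>, which makes up for the rounding
    down in the choice of \<open>c\<close>.\<close>
  then have "real (Suc c) \<le> real (weak_chromatic_number {0..<n} ?E)" by simp
  then have "1 / real d * ln (real n) / ln (ln (real n)) \<le> real (weak_chromatic_number {0..<n} ?E)"
    using c(2) by simp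
  moreover have "embeddable d {0..<n} ?E TYPE(real ^ 'n)"
    using assms by (intro embeddable_if_noncrossing[OF assms(2) h(2) V(1) _ E nc]) auto
  ultimately show "\<exists>E. uniform_hypergraph d {0..<n} E \<and> embeddable d {0..<n} E TYPE(real ^ 'n) \<and>
      1 / real d * ln (real n) / ln (ln (real n)) \<le> real (weak_chromatic_number {0..<n} E)"
    using uniform by blast
qed

end
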